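(* Let $(\rho_{\mathfrak g},\rho_V,\vartheta_V,\vartheta_{\mathfrak g})$ be an extreme matched pair of $n$-Lie algebras $\mathfrak g$ and $V$. The assignment $r\mapsto\mathrm{Gr}(r)=\{r(u)+u\mid u\in V\}$ is a bijection from deformation maps $r:V\to\mathfrak g$ of the matched pair to complements of $\mathfrak g$ in $\mathfrak g\bowtie V$. Two complements $\mathrm{Gr}(r)$ and $\mathrm{Gr}(r')$ are isomorphic as $n$-Lie algebras if and only if there is a linear isomorphism $\sigma:V\to V$ satisfying $$\sigma(H_r(u_1,\dots,u_n))=H_{r'}(\sigma(u_1),\dots,\sigma(u_n))\qquad\text{for all }u_1,\dots,u_n\in V.$$
   Context: $K$ is a field of characteristic zero; vector spaces are over $K$, all maps are linear; $n\ge2$; a hat denotes omission. An $n$-Lie algebra is a vector space with an alternating $n$-linear bracket (an $n$-Lie bracket) satisfying $[z_1,\dots,z_{n-1},[w_1,\dots,w_n]]=\sum_{i=1}^n[w_1,\dots,w_{i-1},[z_1,\dots,z_{n-1},w_i],w_{i+1},\dots,w_n]$. An extreme matched pair is a quadruple of linear maps $\rho_{\mathfrak g}:\bigwedge^{n-1}\mathfrak g\to\mathrm{End}(V)$, $\rho_V:\bigwedge^{n-1}V\to\mathrm{End}(\mathfrak g)$, $\vartheta_V:V\to\mathrm{Hom}(\bigwedge^{n-1}\mathfrak g,\mathfrak g)$, $\vartheta_{\mathfrak g}:\mathfrak g\to\mathrm{Hom}(\bigwedge^{n-1}V,V)$ such that $$\begin{aligned}[x_1+u_1,\dots,x_n+u_n]_{\bowtie}={}&[x_1,\dots,x_n]_{\mathfrak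 g}+\sum_{i=1}^n(-1)^{i-1}\vartheta_V(u_i)(x_1,\dots,\widehat{x_i},\dots,x_n)+\sum_{i=1}^n(-1)^{n-i}\rho_V(u_1,\dots,\widehat{u_i},\dots,u_n)x_i\\&+[u_1,\dots,u_n]_V+\sum_{i=1}^n(-1)^{n-i}\rho_{\mathfrak g}(x_1,\dots,\widehat{x_i},\dots,x_n)u_i+\sum_{i=1}^n(-1)^{n-i}\vartheta_{\mathfrak g}(x_i)(u_1,\dots,\widehat{u_i},\dots,u_n)\end{aligned}$$ is an $n$-Lie bracket on $\mathfrak g\oplus V$; the resulting $n$-Lie algebra is $\mathfrak g\bowtie V$. A complement of $\mathfrak g$ in $\mathfrak g\bowtie V$ is an $n$-Lie subalgebra $\overline V$ with $\mathfrak g\bowtie V=\mathfrak g\oplus\overline V$ as vector spaces. For linear $r:V\to\mathfrak g$ put $$\begin{aligned}G_r(u_1,\dots,u_n)={}&[r(u_1),\dots,r(u_n)]_{\mathfrak g}+\sum_{i=1}^n(-1)^{i-1}\vartheta_V(u_i)(r(u_1),\dots,\widehat{r(u_i)},\dots,r(u_n))\\&+\sum_{i=1}^n(-1)^{n-i}\rho_V(u_1,\dots,\widehat{u_i},\dots,u_n)r(u_i),\\ H_r(u_1,\dots,u_n)={}&[u_1,\dots,u_n]_V+\sum_{i=1}^n(-1)^{n-i}\rho_{\mathfrak g}(r(u_1),\dots,\widehat{r(u_i)},\dots,r(u_n))u_i\\&+\sum_{i=1}^n(-1)^{n-i}\vartheta_{\mathfrak g}(r(u_i))(u_1,\dots,\widehat{u_i},\dots,u_n).\end{aligned}$$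 $r$ is a deformation map if $G_r(u_1,\dots,u_n)=r(H_r(u_1,\dots,u_n))$ for all $u_1,\dots,u_n\in V$. *)

theory Defs
  imports "HOL-Analysis.Product_Vector"
begin

text \<open>
  Arguments of an \<open>m\<close>-ary map are given as a list. Only the values on lists of length \<open>m\<close>
  matter. List positions start at \<open>0\<close>, so the argument usually numbered \<open>i\<close> is \<open>xs ! (i - 1)\<close>,
  and the signs \<open>(-1)^(i-1)\<close> and \<open>(-1)^(n-i)\<close> become \<open>(-1)^i\<close> and \<open>(-1)^(n-1-i)\<close>.
\<close>

definition omit :: "nat \<Rightarrow> 'a list \<Rightarrow> 'a list" where
  "omit i xs = take i xs @ drop (Suc i) xs"

definition multilinear ::
  "('k::field \<Rightarrow> 'a::ab_group_add \<Rightarrow> 'a) \<Rightarrow> ('k \<Rightarrow> 'b::ab_group_add \<Rightarrow> 'b) \<Rightarrow> nat \<Rightarrow> ('a list \<Rightarrow> 'b) \<Rightarrow> bool"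
  where "multilinear s t m f \<longleftrightarrow>
    (\<forall>xs ys. length xs + 1 + length ys = m \<longrightarrow> Vector_Spaces.linear s t (\<lambda>x. f (xs @ [x] @ ys)))"

definition alternating :: "nat \<Rightarrow> ('a list \<Rightarrow> 'b::zero) \<Rightarrow> bool" where
  "alternating m f \<longleftrightarrow> (\<forall>xs. length xs = m \<longrightarrow> \<not> distinct xs \<longrightarrow> f xs = 0)"

text \<open>
  Linear maps out of the \<open>m\<close>-th exterior power are rendered, by its universal property, as
  alternating \<open>m\<close>-linear maps.
\<close>

definition exterior_linear ::
  "('k::field \<Rightarrow> 'a::ab_group_add \<Rightarrow> 'a) \<Rightarrow> ('k \<Rightarrow> 'b::ab_group_add \<Rightarrow> 'b) \<Rightarrow> nat \<Rightarrow> ('a list \<Rightarrow> 'b) \<Rightarrow> bool"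
  where "exterior_linear s t m f \<longleftrightarrow> multilinear s t m f \<and> alternating m f"

locale n_Lie_algebra = vector_space scale
  for n :: nat
    and scale :: "'k::field \<Rightarrow> 'a::ab_group_add \<Rightarrow> 'a"
    and bracket :: "'a list \<Rightarrow> 'a" +
  assumes bracket_exterior_linear: "exterior_linear scale scale n bracket"
    and fundamental_identity:
      "\<And>zs ws. length zs = n - 1 \<Longrightarrow> length ws = n \<Longrightarrow>
        bracket (zs @ [bracket ws]) = (\<Sum>i<n. bracket (ws[i := bracket (zs @ [ws ! i])]))"

definition n_Lie_subalgebra ::
  "nat \<Rightarrow> ('k::field \<Rightarrow> 'a::ab_group_add \<Rightarrow> 'a) \<Rightarrow> ('a list \<Rightarrow> 'a) \<Rightarrow> 'a set \<Rightarrow> bool"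
  where "n_Lie_subalgebra n s br W \<longleftrightarrow>
    module.subspace s W \<and> (\<forall>ws. length ws = n \<and> set ws \<subseteq> W \<longrightarrow> br ws \<in> W)"

text \<open>
  Isomorphism of subalgebras \<open>A\<close> and \<open>B\<close>, each with the restricted operations. The map \<open>f\<close> is
  constrained only on \<open>A\<close>, so linearity is stated relative to \<open>A\<close>.
\<close>

definition n_Lie_subalgebras_isomorphic ::
  "nat \<Rightarrow> ('k::field \<Rightarrow> 'a::ab_group_add \<Rightarrow> 'a) \<Rightarrow> ('a list \<Rightarrow> 'a) \<Rightarrow> 'a set \<Rightarrow> 'a set \<Rightarrow> bool"
  where "n_Lie_subalgebras_isomorphic n s br A B \<longleftrightarrow>
    (\<exists>f. bij_betw f A B \<and>
      (\<forall>x\<in>A. \<forall>y\<in>A. f (x + y) = f x + f y) \<and>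
      (\<forall>c. \<forall>x\<in>A. f (s c x) = s c (f x)) \<and>
      (\<forall>xs. length xs = n \<and> set xs \<subseteq> A \<longrightarrow> f (br xs) = br (map f xs)))"

text \<open>
  Naming of parameters below: \<open>sg\<close>, \<open>sV\<close> are the scalar multiplications and \<open>bg\<close>, \<open>bV\<close> the
  brackets of \<open>\<gg>\<close> and \<open>V\<close>; \<open>rg\<close>, \<open>rV\<close>, \<open>tV\<close>, \<open>tg\<close> stand for the maps
  \<open>\<rho>\<^sub>\<gg>\<close>, \<open>\<rho>\<^sub>V\<close>, \<open>\<theta>\<^sub>V\<close>, \<open>\<theta>\<^sub>\<gg>\<close>. The direct sum of \<open>\<gg>\<close> and \<open>V\<close> is the product type, and a pair
  \<open>(x, u)\<close> is the vector \<open>x + u\<close>.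
\<close>

definition bowtie_bracket ::
  "nat \<Rightarrow> ('k::field_char_0 \<Rightarrow> 'g::ab_group_add \<Rightarrow> 'g) \<Rightarrow> ('k \<Rightarrow> 'v::ab_group_add \<Rightarrow> 'v) \<Rightarrow>
   ('g list \<Rightarrow> 'g) \<Rightarrow> ('v list \<Rightarrow> 'v) \<Rightarrow>
   ('g list \<Rightarrow> 'v \<Rightarrow> 'v) \<Rightarrow> ('v list \<Rightarrow> 'g \<Rightarrow> 'g) \<Rightarrow> ('v \<Rightarrow> 'g list \<Rightarrow> 'g) \<Rightarrow> ('g \<Rightarrow> 'v list \<Rightarrow> 'v) \<Rightarrow>
   ('g \<times> 'v) list \<Rightarrow> 'g \<times> 'v"
  where "bowtie_bracket n sg sV bg bV rg rV tV tg zs =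
    (let xs = map fst zs; us = map snd zs in
      (bg xs
         + (\<Sum>i<n. sg ((-1) ^ i) (tV (us ! i) (omit i xs)))
         + (\<Sum>i<n. sg ((-1) ^ (n - 1 - i)) (rV (omit i us) (xs ! i))),
       bV us
         + (\<Sum>i<n. sV ((-1) ^ (n - 1 - i)) (rg (omit i xs) (us ! i)))
         + (\<Sum>i<n. sV ((-1) ^ (n - 1 - i)) (tg (xs ! i) (omit i us)))))"

definition extreme_matched_pair ::
  "nat \<Rightarrow> ('k::field_char_0 \<Rightarrow> 'g::ab_group_add \<Rightarrow> 'g) \<Rightarrow> ('k \<Rightarrow> 'v::ab_group_add \<Rightarrow> 'v) \<Rightarrow>
   ('g list \<Rightarrow> 'g) \<Rightarrow> ('v list \<Rightarrow> 'v) \<Rightarrow>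
   ('g list \<Rightarrow> 'v \<Rightarrow> 'v) \<Rightarrow> ('v list \<Rightarrow> 'g \<Rightarrow> 'g) \<Rightarrow> ('v \<Rightarrow> 'g list \<Rightarrow> 'g) \<Rightarrow> ('g \<Rightarrow> 'v list \<Rightarrow> 'v) \<Rightarrow> bool"
  where "extreme_matched_pair n sg sV bg bV rg rV tV tg \<longleftrightarrow>
    n_Lie_algebra n sg bg \<and> n_Lie_algebra n sV bV \<and>
    (\<forall>u. exterior_linear sg sV (n - 1) (\<lambda>xs. rg xs u)) \<and>
    (\<forall>xs. length xs = n - 1 \<longrightarrow> Vector_Spaces.linear sV sV (rg xs)) \<and>
    (\<forall>x. exterior_linear sV sg (n - 1) (\<lambda>us. rV us x)) \<and>
    (\<forall>us. length us = n - 1 \<longrightarrow> Vector_Spaces.linear sg sg (rV us)) \<and>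
    (\<forall>u. exterior_linear sg sg (n - 1) (tV u)) \<and>
    (\<forall>xs. length xs = n - 1 \<longrightarrow> Vector_Spaces.linear sV sg (\<lambda>u. tV u xs)) \<and>
    (\<forall>x. exterior_linear sV sV (n - 1) (tg x)) \<and>
    (\<forall>us. length us = n - 1 \<longrightarrow> Vector_Spaces.linear sg sV (\<lambda>x. tg x us)) \<and>
    n_Lie_algebra n (module_prod.scale sg sV) (bowtie_bracket n sg sV bg bV rg rV tV tg)"

definition bowtie_complement ::
  "nat \<Rightarrow> ('k::field_char_0 \<Rightarrow> 'g::ab_group_add \<Rightarrow> 'g) \<Rightarrow> ('k \<Rightarrow> 'v::ab_group_add \<Rightarrow> 'v) \<Rightarrow>
   ('g list \<Rightarrow> 'g) \<Rightarrow> ('v list \<Rightarrow> 'v) \<Rightarrow>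
   ('g list \<Rightarrow> 'v \<Rightarrow> 'v) \<Rightarrow> ('v list \<Rightarrow> 'g \<Rightarrow> 'g) \<Rightarrow> ('v \<Rightarrow> 'g list \<Rightarrow> 'g) \<Rightarrow> ('g \<Rightarrow> 'v list \<Rightarrow> 'v) \<Rightarrow>
   ('g \<times> 'v) set \<Rightarrow> bool"
  where "bowtie_complement n sg sV bg bV rg rV tV tg W \<longleftrightarrow>
    n_Lie_subalgebra n (module_prod.scale sg sV) (bowtie_bracket n sg sV bg bV rg rV tV tg) W \<and>
    {a + w | a w. a \<in> UNIV \<times> {0} \<and> w \<in> W} = UNIV \<and>
    (UNIV \<times> {0}) \<inter> W = {0}"

definition G_map ::
  "nat \<Rightarrow> ('k::field_char_0 \<Rightarrow> 'g::ab_group_add \<Rightarrow> 'g) \<Rightarrow> ('g list \<Rightarrow> 'g) \<Rightarrow>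
   ('v list \<Rightarrow> 'g \<Rightarrow> 'g) \<Rightarrow> ('v \<Rightarrow> 'g list \<Rightarrow> 'g) \<Rightarrow> ('v \<Rightarrow> 'g) \<Rightarrow> 'v list \<Rightarrow> 'g"
  where "G_map n sg bg rV tV r us =
    bg (map r us)
      + (\<Sum>i<n. sg ((-1) ^ i) (tV (us ! i) (omit i (map r us))))
      + (\<Sum>i<n. sg ((-1) ^ (n - 1 - i)) (rV (omit i us) (r (us ! i))))"

definition H_map ::
  "nat \<Rightarrow> ('k::field_char_0 \<Rightarrow> 'v::ab_group_add \<Rightarrow> 'v) \<Rightarrow> ('v list \<Rightarrow> 'v) \<Rightarrow>
   ('g list \<Rightarrow> 'v \<Rightarrow> 'v) \<Rightarrow> ('g \<Rightarrow> 'v list \<Rightarrow> 'v) \<Rightarrow> ('v \<Rightarrow> 'g) \<Rightarrow> 'v list \<Rightarrow> 'v"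
  where "H_map n sV bV rg tg r us =
    bV us
      + (\<Sum>i<n. sV ((-1) ^ (n - 1 - i)) (rg (omit i (map r us)) (us ! i)))
      + (\<Sum>i<n. sV ((-1) ^ (n - 1 - i)) (tg (r (us ! i)) (omit i us)))"

definition deformation_map ::
  "nat \<Rightarrow> ('k::field_char_0 \<Rightarrow> 'g::ab_group_add \<Rightarrow> 'g) \<Rightarrow> ('k \<Rightarrow> 'v::ab_group_add \<Rightarrow> 'v) \<Rightarrow>
   ('g list \<Rightarrow> 'g) \<Rightarrow> ('v list \<Rightarrow> 'v) \<Rightarrow>
   ('g list \<Rightarrow> 'v \<Rightarrow> 'v) \<Rightarrow> ('v list \<Rightarrow> 'g \<Rightarrow> 'g) \<Rightarrow> ('v \<Rightarrow> 'g list \<Rightarrow> 'g) \<Rightarrow> ('g \<Rightarrow> 'v list \<Rightarrow> 'v) \<Rightarrow>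
   ('v \<Rightarrow> 'g) \<Rightarrow> bool"
  where "deformation_map n sg sV bg bV rg rV tV tg r \<longleftrightarrow>
    Vector_Spaces.linear sV sg r \<and>
    (\<forall>us. length us = n \<longrightarrow> G_map n sg bg rV tV r us = r (H_map n sV bV rg tg r us))"

definition Gr :: "('v \<Rightarrow> 'g) \<Rightarrow> ('g \<times> 'v) set" where
  "Gr r = {(r u, u) | u. True}"

end

theory Submission
  imports Defs
begin

text \<open>
  A linear complement of \<open>\<gg>\<close> in \<open>\<gg> \<oplus> V\<close> meets each coset \<open>\<gg> + u\<close> in exactly one point
  \<open>r(u) + u\<close>, so it is the graph of a unique linear map \<open>r\<close>
  (\<open>linear_complement_iff_graph\<close>). The bracket enters through a single computation: by the
  definitions of \<open>G\<close> and \<open>H\<close>,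
  \<open>[r(u\<^sub>1) + u\<^sub>1, \<dots>, r(u\<^sub>n) + u\<^sub>n] = G\<^sub>r(u\<^sub>1, \<dots>, u\<^sub>n) + H\<^sub>r(u\<^sub>1, \<dots>, u\<^sub>n)\<close>
  is the decomposition of the left-hand side into its components in \<open>\<gg>\<close> and \<open>V\<close>
  (\<open>bowtie_bracket_graph\<close>). Such a vector lies on the graph of \<open>r\<close> exactly if
  \<open>G\<^sub>r = r \<circ> H\<^sub>r\<close> at \<open>u\<^sub>1, \<dots>, u\<^sub>n\<close>. Hence the graph is closed
  under the bracket if and only if \<open>r\<close> is a deformation map.

  For a deformation map \<open>r\<close>, the same formula says that the projection to \<open>V\<close>, whose inverse
  is \<open>u \<mapsto> r(u) + u\<close>, carries the bracket of \<open>Gr(r)\<close> to \<open>H\<^sub>r\<close>. Transporting along these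
  projections turns isomorphisms \<open>Gr(r) \<rightarrow> Gr(r')\<close> into linear bijections of \<open>V\<close> that
  intertwine the operations \<open>H\<close> of \<open>r\<close> and \<open>r'\<close> (\<open>graphs_isomorphic_iff\<close>).
\<close>

section \<open>Graphs as linear complements\<close>

lemma Pair_in_Gr_iff [simp]: "(x, u) \<in> Gr r \<longleftrightarrow> x = r u"
  by (auto simp: Gr_def)

lemma inj_Gr: "inj Gr"
proof (rule injI)
  fix r r' :: "'v \<Rightarrow> 'g"
  assume "Gr r = Gr r'"
  then have "(r u, u) \<in> Gr r'" for u by (metis Pair_in_Gr_iff)
  then show "r = r'" by auto
qed

lemma list_in_Gr_eq_map:
  assumes "set zs \<subseteq> Gr r"
  shows "zs = map (\<lambda>u. (r u, u)) (map snd zs)"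
  using assms by (induction zs) (auto simp: Gr_def)

context vector_space_prod
begin

lemma subspace_Gr_iff: "p.subspace (Gr r) \<longleftrightarrow> Vector_Spaces.linear s2 s1 r"
proof
  assume sub: "p.subspace (Gr r)"
  have mem: "(r u, u) \<in> Gr r" for u by simp
  have "r (u + v) = r u + r v" for u v
    using p.subspace_add[OF sub mem mem, of u v] by simp
  moreover have "r (s2 c u) = s1 c (r u)" for c u
    using p.subspace_scale[OF sub mem, of c u] by (simp add: scale_prod)
  ultimately show "Vector_Spaces.linear s2 s1 r"
    by (simp add: Vector_Spaces.linear_iff vs1.vector_space_axioms vs2.vector_space_axioms)
next
  assume "Vector_Spaces.linear s2 s1 r"
  then interpret r: Vector_Spaces.linear s2 s1 r .
  show "p.subspace (Gr r)"
    unfolding p.subspace_def by (auto simp: zero_prod_def scale_prod r.add r.scale)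
qed

text \<open>
  The sum condition provides a point of the complement over each \<open>u\<close>; two such points differ by
  an element of \<open>\<gg>\<close>, so trivial intersection makes the point unique, and its first component
  is the value \<open>r(u)\<close>.
\<close>

lemma linear_complement_iff_graph:
  "p.subspace W \<and> {a + w | a w. a \<in> UNIV \<times> {0} \<and> w \<in> W} = UNIV \<and> (UNIV \<times> {0}) \<inter> W = {0}
     \<longleftrightarrow> (\<exists>r. Vector_Spaces.linear s2 s1 r \<and> W = Gr r)"
  (is "?complement \<longleftrightarrow> ?graph")
proof
  assume complement: ?complement
  then have sub: "p.subspace W" by simp
  have ex: "\<exists>x. (x, u) \<in> W" for u
  proof -
    have "(0, u) \<in> {a + w | a w. a \<in> UNIV \<times> {0} \<and> w \<in> W}" using complement by simp
    then show ?thesis by force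
  qed
  have unique: "x = y" if "(x, u) \<in> W" "(y, u) \<in> W" for x y u
  proof -
    have "(x - y, 0) \<in> (UNIV \<times> {0}) \<inter> W" using p.subspace_diff[OF sub that] by simp
    then show ?thesis using complement by (simp add: zero_prod_def)
  qed
  define r where "r u = (THE x. (x, u) \<in> W)" for u
  have "(r u, u) \<in> W" for u
    unfolding r_def by (rule theI') (use ex unique in blast)
  then have "W = Gr r"
    using unique by (auto simp: Gr_def)
  then show ?graph using sub subspace_Gr_iff by blast
next
  assume ?graph
  then obtain r where r: "Vector_Spaces.linear s2 s1 r" and W: "W = Gr r" by blast
  interpret r: Vector_Spaces.linear s2 s1 r by (rule r)
  have "\<exists>a w. z = a + w \<and> a \<in> UNIV \<times> {0} \<and> w \<in> W" for z
  proof (intro exI conjI)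
    show "z = (fst z - r (snd z), 0) + (r (snd z), snd z)" by (simp add: prod_eq_iff)
  qed (simp_all add: W)
  moreover have "(UNIV \<times> {0}) \<inter> W = {0}"
    by (auto simp: W zero_prod_def)
  moreover have "p.subspace W" using r W subspace_Gr_iff by simp
  ultimately show ?complement by blast
qed

section \<open>Isomorphisms between graphs\<close>

text \<open>
  The hypotheses on \<open>H\<close> and \<open>H'\<close> say that these are the operations that \<open>br\<close> induces on
  \<open>V\<close> through the two graphs. An isomorphism \<open>f\<close> of the graphs corresponds to
  \<open>\<sigma>(u) = snd (f (r(u), u))\<close>.
\<close>

lemma graphs_isomorphic_iff:
  assumes r: "Vector_Spaces.linear s2 s1 r" and r': "Vector_Spaces.linear s2 s1 r'"
    and H: "\<And>us. length us = n \<Longrightarrow> br (map (\<lambda>u. (r u, u)) us) = (r (H us), H us)"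
    and H': "\<And>us. length us = n \<Longrightarrow> br (map (\<lambda>u. (r' u, u)) us) = (r' (H' us), H' us)"
  shows "n_Lie_subalgebras_isomorphic n scale br (Gr r) (Gr r') \<longleftrightarrow>
    (\<exists>\<sigma>. Vector_Spaces.linear s2 s2 \<sigma> \<and> bij \<sigma> \<and>
      (\<forall>us. length us = n \<longrightarrow> \<sigma> (H us) = H' (map \<sigma> us)))"
    (is "_ \<longleftrightarrow> (\<exists>\<sigma>. ?intertwines \<sigma>)")
proof
  assume "n_Lie_subalgebras_isomorphic n scale br (Gr r) (Gr r')"
  then obtain f where bij: "bij_betw f (Gr r) (Gr r')"
    and add: "\<And>x y. x \<in> Gr r \<Longrightarrow> y \<in> Gr r \<Longrightarrow> f (x + y) = f x + f y"
    and scale: "\<And>c x. x \<in> Gr r \<Longrightarrow> f (scale c x) = scale c (f x)"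
    and bracket: "\<And>xs. length xs = n \<Longrightarrow> set xs \<subseteq> Gr r \<Longrightarrow> f (br xs) = br (map f xs)"
    unfolding n_Lie_subalgebras_isomorphic_def by blast
  interpret r: Vector_Spaces.linear s2 s1 r by (rule r)
  define \<sigma> where "\<sigma> u = snd (f (r u, u))" for u
  have f: "f (r u, u) = (r' (\<sigma> u), \<sigma> u)" for u
  proof -
    have "f (r u, u) \<in> Gr r'" using bij by (auto dest: bij_betwE)
    then show ?thesis by (cases "f (r u, u)") (simp add: \<sigma>_def)
  qed
  have "\<sigma> (u + v) = \<sigma> u + \<sigma> v" for u v
    using add[of "(r u, u)" "(r v, v)"] by (simp add: f flip: r.add)
  moreover have "\<sigma> (s2 c u) = s2 c (\<sigma> u)" for c u
    using scale[of "(r u, u)" c] by (simp add: f scale_prod flip: r.scale)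
  ultimately have "Vector_Spaces.linear s2 s2 \<sigma>"
    by (simp add: Vector_Spaces.linear_iff vs2.vector_space_axioms)
  moreover have "bij \<sigma>"
  proof (rule bijI)
    show "inj \<sigma>"
    proof (rule injI)
      fix u v assume "\<sigma> u = \<sigma> v"
      then have "f (r u, u) = f (r v, v)" by (simp add: f)
      then show "u = v" using bij by (auto simp: bij_betw_def dest: inj_onD)
    qed
    show "surj \<sigma>"
      unfolding surj_def
    proof
      fix v
      have "(r' v, v) \<in> f ` Gr r" using bij by (simp add: bij_betw_def)
      then show "\<exists>u. v = \<sigma> u" by (auto simp: Gr_def f)
    qed
  qed
  moreover have "\<sigma> (H us) = H' (map \<sigma> us)" if us: "length us = n" for us
  proof -
    have "f (r (H us), H us) = br (map f (map (\<lambda>u. (r u, u)) us))"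
      using bracket[of "map (\<lambda>u. (r u, u)) us"] us by (simp add: H image_subset_iff)
    also have "\<dots> = br (map (\<lambda>u. (r' u, u)) (map \<sigma> us))" by (simp add: f comp_def)
    also have "\<dots> = (r' (H' (map \<sigma> us)), H' (map \<sigma> us))" using us by (intro H') simp
    finally show ?thesis by (simp add: f)
  qed
  ultimately show "\<exists>\<sigma>. ?intertwines \<sigma>" by blast
next
  assume "\<exists>\<sigma>. ?intertwines \<sigma>"
  then obtain \<sigma> where \<sigma>: "Vector_Spaces.linear s2 s2 \<sigma>" and bij: "bij \<sigma>"
    and inter: "\<And>us. length us = n \<Longrightarrow> \<sigma> (H us) = H' (map \<sigma> us)"
    by blast
  interpret r': Vector_Spaces.linear s2 s1 r' by (rule r')
  interpret \<sigma>: Vector_Spaces.linear s2 s2 \<sigma> by (rule \<sigma>)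
  define f :: "'b \<times> 'c \<Rightarrow> 'b \<times> 'c" where "f z = (r' (\<sigma> (snd z)), \<sigma> (snd z))" for z
  have "bij_betw f (Gr r) (Gr r')"
    unfolding bij_betw_def
  proof
    show "inj_on f (Gr r)"
      using bij by (auto simp: inj_on_def f_def Gr_def bij_def)
    show "f ` Gr r = Gr r'"
    proof
      show "f ` Gr r \<subseteq> Gr r'" by (auto simp: f_def)
      show "Gr r' \<subseteq> f ` Gr r"
      proof
        fix z assume "z \<in> Gr r'"
        then obtain v where z: "z = (r' v, v)" by (auto simp: Gr_def)
        obtain u where "v = \<sigma> u" using bij by (metis bij_pointE)
        then have "z = f (r u, u)" by (simp add: z f_def)
        then show "z \<in> f ` Gr r" by (rule image_eqI) simp
      qed
    qed
  qed
  moreover have "f (x + y) = f x + f y" for x y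
    by (simp add: f_def \<sigma>.add r'.add)
  moreover have "f (scale c x) = scale c (f x)" for c x
    by (simp add: f_def scale_def \<sigma>.scale r'.scale)
  moreover have "f (br xs) = br (map f xs)" if "length xs = n" "set xs \<subseteq> Gr r" for xs
  proof -
    define us where "us = map snd xs"
    have us: "length us = n" "xs = map (\<lambda>u. (r u, u)) us"
      using that list_in_Gr_eq_map by (auto simp only: us_def length_map)
    have "f (br xs) = (r' (H' (map \<sigma> us)), H' (map \<sigma> us))"
      by (simp add: us H f_def inter)
    also have "\<dots> = br (map (\<lambda>u. (r' u, u)) (map \<sigma> us))"
      using us(1) by (intro H'[symmetric]) simp
    also have "\<dots> = br (map f xs)"
      by (simp add: us(2) f_def comp_def)
    finally show ?thesis .
  qed
  ultimately show "n_Lie_subalgebras_isomorphic n scale br (Gr r) (Gr r')"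
    unfolding n_Lie_subalgebras_isomorphic_def by blast
qed

end

section \<open>The bracket on a graph\<close>

lemma bowtie_bracket_graph:
  assumes "length us = n"
  shows "bowtie_bracket n sg sV bg bV rg rV tV tg (map (\<lambda>u. (r u, u)) us) =
    (G_map n sg bg rV tV r us, H_map n sV bV rg tg r us)"
  using assms by (simp add: bowtie_bracket_def G_map_def H_map_def Let_def comp_def)

text \<open>
  Each list in the graph is the lift of its list of second components, so closure only has to be
  tested on lifts, where the bracket has components \<open>G\<^sub>r\<close> and \<open>H\<^sub>r\<close>.
\<close>

lemma graph_closed_iff_deformation_map:
  assumes "Vector_Spaces.linear sV sg r"
  shows "(\<forall>ws. length ws = n \<and> set ws \<subseteq> Gr r \<longrightarrow>
            bowtie_bracket n sg sV bg bV rg rV tV tg ws \<in> Gr r)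
     \<longleftrightarrow> deformation_map n sg sV bg bV rg rV tV tg r" (is "?closed \<longleftrightarrow> _")
proof -
  have "?closed \<longleftrightarrow> (\<forall>us. length us = n \<longrightarrow>
    bowtie_bracket n sg sV bg bV rg rV tV tg (map (\<lambda>u. (r u, u)) us) \<in> Gr r)" (is "_ \<longleftrightarrow> ?on_lifts")
  proof
    assume closed: ?closed
    show ?on_lifts
    proof (intro allI impI)
      fix us :: "'b list" assume "length us = n"
      then show "bowtie_bracket n sg sV bg bV rg rV tV tg (map (\<lambda>u. (r u, u)) us) \<in> Gr r"
        using closed[rule_format, of "map (\<lambda>u. (r u, u)) us"] by (simp add: image_subset_iff)
    qed
  next
    assume on_lifts: ?on_lifts
    show ?closed
    proof (intro allI impI, elim conjE)
      fix ws :: "('c \<times> 'b) list" assume ws: "length ws = n" "set ws \<subseteq> Gr r"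
      show "bowtie_bracket n sg sV bg bV rg rV tV tg ws \<in> Gr r"
        using on_lifts[rule_format, of "map snd ws"] ws(1)
        by (simp only: length_map list_in_Gr_eq_map[OF ws(2), symmetric])
    qed
  qed
  then show ?thesis
    using assms by (simp add: bowtie_bracket_graph deformation_map_def)
qed

lemma bowtie_complement_iff_Gr_deformation_map:
  assumes "vector_space sg" "vector_space sV"
  shows "bowtie_complement n sg sV bg bV rg rV tV tg W \<longleftrightarrow>
    (\<exists>r. deformation_map n sg sV bg bV rg rV tV tg r \<and> W = Gr r)"
    (is "_ \<longleftrightarrow> ?rhs")
proof -
  interpret vector_space_prod sg sV
    using assms by (simp add: vector_space_prod_def vector_space_pair_def)
  have "bowtie_complement n sg sV bg bV rg rV tV tg W \<longleftrightarrow>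
      (\<exists>r. Vector_Spaces.linear sV sg r \<and> W = Gr r) \<and>
      (\<forall>ws. length ws = n \<and> set ws \<subseteq> W \<longrightarrow> bowtie_bracket n sg sV bg bV rg rV tV tg ws \<in> W)"
    unfolding bowtie_complement_def n_Lie_subalgebra_def linear_complement_iff_graph[symmetric]
    by blast
  also have "\<dots> \<longleftrightarrow> ?rhs"
    using graph_closed_iff_deformation_map[of sV sg _ n bg bV rg rV tV tg]
    by (auto simp: deformation_map_def)
  finally show ?thesis .
qed

theorem theorem7p3:
  fixes n :: nat
    and sg :: "'k::field_char_0 \<Rightarrow> 'g::ab_group_add \<Rightarrow> 'g"
    and sV :: "'k \<Rightarrow> 'v::ab_group_add \<Rightarrow> 'v"
    and bg :: "'g list \<Rightarrow> 'g" and bV :: "'v list \<Rightarrow> 'v"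
    and rg :: "'g list \<Rightarrow> 'v \<Rightarrow> 'v" and rV :: "'v list \<Rightarrow> 'g \<Rightarrow> 'g"
    and tV :: "'v \<Rightarrow> 'g list \<Rightarrow> 'g" and tg :: "'g \<Rightarrow> 'v list \<Rightarrow> 'v"
  assumes "n \<ge> 2"
    and "extreme_matched_pair n sg sV bg bV rg rV tV tg"
  shows "bij_betw Gr {r. deformation_map n sg sV bg bV rg rV tV tg r}
                     {W. bowtie_complement n sg sV bg bV rg rV tV tg W} \<and>
    (\<forall>r r'. deformation_map n sg sV bg bV rg rV tV tg r \<longrightarrow>
            deformation_map n sg sV bg bV rg rV tV tg r' \<longrightarrow>
       (n_Lie_subalgebras_isomorphic n (module_prod.scale sg sV)
          (bowtie_bracket n sg sV bg bV rg rV tV tg) (Gr r) (Gr r') \<longleftrightarrow>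
        (\<exists>\<sigma>. Vector_Spaces.linear sV sV \<sigma> \<and> bij \<sigma> \<and>
          (\<forall>us. length us = n \<longrightarrow>
             \<sigma> (H_map n sV bV rg tg r us) = H_map n sV bV rg tg r' (map \<sigma> us)))))"
proof -
  have vs: "vector_space sg" "vector_space sV"
    using assms(2) by (simp_all add: extreme_matched_pair_def n_Lie_algebra_def)
  interpret vector_space_prod sg sV
    using vs by (simp add: vector_space_prod_def vector_space_pair_def)
  have "bij_betw Gr {r. deformation_map n sg sV bg bV rg rV tV tg r}
                    {W. bowtie_complement n sg sV bg bV rg rV tV tg W}"
    by (auto simp: bij_betw_def bowtie_complement_iff_Gr_deformation_map[OF vs]
        intro: inj_on_subset[OF inj_Gr])
  moreover have "n_Lie_subalgebras_isomorphic n scale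
      (bowtie_bracket n sg sV bg bV rg rV tV tg) (Gr r) (Gr r') \<longleftrightarrow>
      (\<exists>\<sigma>. Vector_Spaces.linear sV sV \<sigma> \<and> bij \<sigma> \<and>
        (\<forall>us. length us = n \<longrightarrow>
           \<sigma> (H_map n sV bV rg tg r us) = H_map n sV bV rg tg r' (map \<sigma> us)))"
    if "deformation_map n sg sV bg bV rg rV tV tg r" "deformation_map n sg sV bg bV rg rV tV tg r'"
    for r r'
    using that by (intro graphs_isomorphic_iff) (auto simp: deformation_map_def bowtie_bracket_graph)
  ultimately show ?thesis by blast
qed

end
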